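(* Let $n\geqslant 1$. A finitely generated subgroup of $\mathrm{GL}(n,\mathbb{Q})$ is Cayley p.f. linear-time computable.
   Context: Position-faithful one-tape Turing machine: a Turing machine with one semi-infinite tape (infinite in one direction only) whose left-most cell contains a special symbol $\boxplus$ which occurs only there and cannot be modified. On input $x\in\Sigma^*$ the initial tape content is $\boxplus x\boxdot^\infty$, where $\boxdot$ is a special blank symbol and $\Sigma\cap\{\boxplus,\boxdot\}=\varnothing$, and the head starts at $\boxplus$. The machine computes $f:\Sigma^*\to\Sigma^*$ if on every input $x\in\Sigma^*$ it eventually reaches an accepting state and halts with the tape having prefix $\boxplus f(x)\boxdot$ (no restriction on the tape content after this first $\boxdot$). A function $f:\Sigma^*\to\Sigma^*$ is position-faithful (p.f.) linear-time computable if it is computed by a deterministic position-faithful one-tape Turing machine in time linear in the input length. Let $G$ be a finitely generated group and $S=\{s_1,\dots,s_m\}\subset G$ a finite set of semigroup generators (every $g\in G$ is a product of elements of $S$). $G$ is Cayley p.f. linear-time computable if there exist a language $L\subseteq\Sigma^*$ (no restriction on the language class) over a finite alphabet $\Sigma$, a bijection $\psi:L\to G$ and p.f. linear-time computable functions $f_i:\Sigma^*\to\Sigma^*$, $i=1,\dots,m$, with $f_i(L)\subseteq L$ and $\psi(f_i(w))=\psi(w)s_i$ for all $w\in L$. This notion does not depend on the choice of $S$. *)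

theory Defs
  imports "HOL-Algebra.Generated_Groups" "Jordan_Normal_Form.Matrix"
begin

text \<open>
  The two special symbols are separate constructors, so they cannot belong to any input alphabet,
  whose elements appear on the tape under \<open>Letter\<close>.
\<close>

datatype 'a symbol = Marker | Blank | Letter 'a

datatype direction = Move_Left | Stay | Move_Right

text \<open>
  The field \<open>work_letters\<close> holds all letters that may occur on the tape, those of the input alphabet
  included. A machine is deterministic, and it halts when its transition function is undefined.
\<close>

record ('q, 'a) tm =
  states :: "'q set"
  work_letters :: "'a set"
  start :: 'q
  accepting :: "'q set"
  delta :: "'q \<Rightarrow> 'a symbol \<Rightarrow> ('q \<times> 'a symbol \<times> direction) option"

definition tape_symbols :: "('q, 'a) tm \<Rightarrow> 'a symbol set" where
  "tape_symbols M = {Marker, Blank} \<union> Letter ` work_letters M"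

text \<open>
  The last two conditions say that the marker is never overwritten, that it is never written
  anywhere else, and that the head never leaves the semi-infinite tape.
\<close>

definition pf_tm :: "'a set \<Rightarrow> ('q, 'a) tm \<Rightarrow> bool" where
  "pf_tm \<Sigma> M \<longleftrightarrow>
     finite (states M) \<and> finite (work_letters M) \<and> \<Sigma> \<subseteq> work_letters M \<and>
     start M \<in> states M \<and> accepting M \<subseteq> states M \<and>
     (\<forall>q\<in>states M. \<forall>a\<in>tape_symbols M. \<forall>q' b d. delta M q a = Some (q', b, d) \<longrightarrow>
        q' \<in> states M \<and> b \<in> tape_symbols M \<and>
        (b = Marker \<longleftrightarrow> a = Marker) \<and>
        (a = Marker \<longrightarrow> d \<noteq> Move_Left))"

type_synonym ('q, 'a) config = "'q \<times> nat \<times> (nat \<Rightarrow> 'a symbol)"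

fun move_head :: "direction \<Rightarrow> nat \<Rightarrow> nat" where
  "move_head Move_Left p = p - 1"
| "move_head Stay p = p"
| "move_head Move_Right p = Suc p"

fun tm_step :: "('q, 'a) tm \<Rightarrow> ('q, 'a) config \<Rightarrow> ('q, 'a) config option" where
  "tm_step M (q, p, t) =
     (case delta M q (t p) of
        None \<Rightarrow> None
      | Some (q', b, d) \<Rightarrow> Some (q', move_head d p, t(p := b)))"

definition transition :: "('q, 'a) tm \<Rightarrow> (('q, 'a) config \<times> ('q, 'a) config) set" where
  "transition M = {(c, c'). tm_step M c = Some c'}"

definition initial_tape :: "'a list \<Rightarrow> nat \<Rightarrow> 'a symbol" where
  "initial_tape x i =
     (if i = 0 then Marker
      else if i \<le> length x then Letter (x ! (i - 1))
      else Blank)"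

definition initial_config :: "('q, 'a) tm \<Rightarrow> 'a list \<Rightarrow> ('q, 'a) config" where
  "initial_config M x = (start M, 0, initial_tape x)"

definition accepts_with_output_in ::
    "('q, 'a) tm \<Rightarrow> 'a list \<Rightarrow> 'a list \<Rightarrow> nat \<Rightarrow> bool" where
  "accepts_with_output_in M x y n \<longleftrightarrow>
     (\<exists>q p t. (initial_config M x, (q, p, t)) \<in> transition M ^^ n \<and>
        tm_step M (q, p, t) = None \<and> q \<in> accepting M \<and>
        map t [0..<length y + 2] = Marker # map Letter y @ [Blank])"

text \<open>
  States and letters are natural numbers, which is no restriction as both sets are finite. The
  time bound is $C(|x|+1)$ rather than $C|x|$ so that it is meaningful for the empty word.
\<close>

definition pf_linear_time_computable :: "nat set \<Rightarrow> (nat list \<Rightarrow> nat list) \<Rightarrow> bool" where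
  "pf_linear_time_computable \<Sigma> f \<longleftrightarrow>
     f ` lists \<Sigma> \<subseteq> lists \<Sigma> \<and>
     (\<exists>(M :: (nat, nat) tm) (C :: nat). pf_tm \<Sigma> M \<and>
        (\<forall>x\<in>lists \<Sigma>. \<exists>n \<le> C * (length x + 1). accepts_with_output_in M x (f x) n))"


definition finitely_generated_group :: "('g, 'b) monoid_scheme \<Rightarrow> bool" where
  "finitely_generated_group G \<longleftrightarrow>
     group G \<and> (\<exists>T. finite T \<and> T \<subseteq> carrier G \<and> generate G T = carrier G)"

definition semigroup_generators :: "('g, 'b) monoid_scheme \<Rightarrow> 'g set \<Rightarrow> bool" where
  "semigroup_generators G S \<longleftrightarrow>
     S \<subseteq> carrier G \<and>
     (\<forall>g\<in>carrier G. \<exists>xs\<in>lists S. xs \<noteq> [] \<and> g = foldr (\<otimes>\<^bsub>G\<^esub>) xs \<one>\<^bsub>G\<^esub>)"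

definition cayley_pf_linear_time_wrt :: "('g, 'b) monoid_scheme \<Rightarrow> 'g set \<Rightarrow> bool" where
  "cayley_pf_linear_time_wrt G S \<longleftrightarrow>
     (\<exists>(\<Sigma> :: nat set) (L :: nat list set) (\<psi> :: nat list \<Rightarrow> 'g) (f :: 'g \<Rightarrow> nat list \<Rightarrow> nat list).
        finite \<Sigma> \<and> L \<subseteq> lists \<Sigma> \<and> bij_betw \<psi> L (carrier G) \<and>
        (\<forall>s\<in>S. pf_linear_time_computable \<Sigma> (f s) \<and> f s ` L \<subseteq> L \<and>
           (\<forall>w\<in>L. \<psi> (f s w) = \<psi> w \<otimes>\<^bsub>G\<^esub> s)))"

text \<open>
  The notion does not depend on the choice of the finite set of semigroup generators. It is
  required here for all of them; a finitely generated group has at least one.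
\<close>

definition cayley_pf_linear_time_computable :: "('g, 'b) monoid_scheme \<Rightarrow> bool" where
  "cayley_pf_linear_time_computable G \<longleftrightarrow>
     finitely_generated_group G \<and>
     (\<exists>S. finite S \<and> semigroup_generators G S) \<and>
     (\<forall>S. finite S \<and> semigroup_generators G S \<longrightarrow> cayley_pf_linear_time_wrt G S)"


definition GL_rat :: "nat \<Rightarrow> rat mat monoid" where
  "GL_rat n = units_of (ring_mat TYPE(rat) n ())"

end

theory Submission
  imports Defs "HOL-Library.More_List"
begin

text \<open>
  Let \<open>b \<ge> 3\<close> be a common denominator of the entries of all generators. Every element of the group is
  a matrix with entries in \<open>\<int>[1/b]\<close>, and every such entry has exactly one finite expansion in base
  \<open>b\<close> with digits from \<open>-1\<close> to \<open>b - 2\<close>. Writing the digits of all entries at equal distance from the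
  radix point into one letter turns a matrix into a word, and the words without trailing zero
  letters are unique normal forms (\<open>trim_eqI\<close>). These words, for the matrices in the group, form the language.

  Right multiplication by a generator \<open>C / b\<close> combines integer linear combinations of the
  entries of a row with a shift by one digit. The first needs only a bounded carry
  (\<open>carry_bound\<close>, \<open>next_carry_in\<close>), so a constant number of sweeps of a finite automaton over the tape
  suffices (\<open>matrix_of_product\<close>, \<open>mul_tm_run\<close>).

  What could cost quadratic time on one tape is position-faithfulness: numerals may grow or shrink at
  both ends, but the output has to start next to the marker. Folding the tape at the radix
  point removes the problem. Integer digits and fractional digits are two tracks that both start at
  the marker, and both ends of the numerals are at the right end of the word, where columns are
  appended or erased without moving anything else.

  The machine multiplies the matrix denoted by any word over the alphabet and outputs the normal form
  of the result. As the generators reach all group elements from the identity, this also shows that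
  each element has a normal form. The machine
  works with letters and states that are arrays of integers; they are replaced by numbers in the end
  (\<open>pf_linear_time_computable_rename\<close>).
\<close>

section \<open>Renaming the states and letters of a machine\<close>

text \<open>
  A machine whose letters and states carry mathematical data is far easier to reason about than one
  over natural numbers. Only injectivity on the finitely many states and letters in use matters for
  replacing them by numbers.
\<close>

definition rename_tm :: "('q \<Rightarrow> 'p) \<Rightarrow> ('a \<Rightarrow> 'b) \<Rightarrow> ('q, 'a) tm \<Rightarrow> ('p, 'b) tm" where
  "rename_tm r e M =
     \<lparr>states = r ` states M, work_letters = e ` work_letters M,
      start = r (start M), accepting = r ` accepting M,
      delta = (\<lambda>q a. map_option (\<lambda>(q', c, d). (r q', map_symbol e c, d))
        (delta M (inv_into (states M) r q) (map_symbol (inv_into (work_letters M) e) a)))\<rparr>"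

fun rename_config :: "('q \<Rightarrow> 'p) \<Rightarrow> ('a \<Rightarrow> 'b) \<Rightarrow> ('q, 'a) config \<Rightarrow> ('p, 'b) config" where
  "rename_config r e (q, p, t) = (r q, p, \<lambda>i. map_symbol e (t i))"

fun well_formed :: "('q, 'a) tm \<Rightarrow> ('q, 'a) config \<Rightarrow> bool" where
  "well_formed M (q, p, t) \<longleftrightarrow> q \<in> states M \<and> range t \<subseteq> tape_symbols M"

lemma pf_tmD:
  assumes "pf_tm \<Sigma> M" "q \<in> states M" "a \<in> tape_symbols M" "delta M q a = Some (q', c, d)"
  shows "q' \<in> states M" "c \<in> tape_symbols M" "c = Marker \<longleftrightarrow> a = Marker"
    "a = Marker \<Longrightarrow> d \<noteq> Move_Left"
  using assms unfolding pf_tm_def by blast+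

context
  fixes M :: "('q, 'a) tm" and r :: "'q \<Rightarrow> 'p" and e :: "'a \<Rightarrow> 'b" and \<Sigma> :: "'a set"
  assumes pf: "pf_tm \<Sigma> M"
    and inj_r: "inj_on r (states M)" and inj_e: "inj_on e (work_letters M)"
begin

lemma map_symbol_inv_into:
  assumes "a \<in> tape_symbols M"
  shows "map_symbol (inv_into (work_letters M) e) (map_symbol e a) = a"
  using assms inj_e by (auto simp: tape_symbols_def)

lemma delta_rename_tm:
  assumes "q \<in> states M" "a \<in> tape_symbols M"
  shows "delta (rename_tm r e M) (r q) (map_symbol e a) =
    map_option (\<lambda>(q', c, d). (r q', map_symbol e c, d)) (delta M q a)"
  using assms by (simp add: rename_tm_def map_symbol_inv_into inj_r)

lemma tape_symbols_rename_tm: "tape_symbols (rename_tm r e M) = map_symbol e ` tape_symbols M"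
  by (simp add: tape_symbols_def rename_tm_def image_Un image_image)

lemma map_symbol_eq_Marker: "map_symbol e a = Marker \<longleftrightarrow> a = Marker"
  by (cases a) auto

lemma pf_tm_rename_tm: "pf_tm (e ` \<Sigma>) (rename_tm r e M)"
proof -
  have closed: "q' \<in> r ` states M \<and> c \<in> map_symbol e ` tape_symbols M \<and>
      (c = Marker \<longleftrightarrow> a = Marker) \<and> (a = Marker \<longrightarrow> d \<noteq> Move_Left)"
    if qa: "q \<in> r ` states M" "a \<in> map_symbol e ` tape_symbols M"
      and d: "delta (rename_tm r e M) q a = Some (q', c, d)" for q a q' c d
  proof -
    obtain q0 a0 where 0: "q = r q0" "q0 \<in> states M" "a = map_symbol e a0" "a0 \<in> tape_symbols M"
      using qa by blast
    then obtain q1 c1 where 1: "delta M q0 a0 = Some (q1, c1, d)" "q' = r q1" "c = map_symbol e c1"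
      using d by (auto simp: delta_rename_tm)
    show ?thesis
      using pf_tmD[OF pf 0(2,4) 1(1)] 0 1 by (auto simp: map_symbol_eq_Marker)
  qed
  have fields: "states (rename_tm r e M) = r ` states M" "work_letters (rename_tm r e M) = e ` work_letters M"
    "start (rename_tm r e M) = r (start M)" "accepting (rename_tm r e M) = r ` accepting M"
    by (simp_all add: rename_tm_def)
  have "finite (states M)" "finite (work_letters M)" "\<Sigma> \<subseteq> work_letters M"
    "start M \<in> states M" "accepting M \<subseteq> states M"
    using pf by (auto simp: pf_tm_def)
  then have basic: "finite (r ` states M)" "finite (e ` work_letters M)" "e ` \<Sigma> \<subseteq> e ` work_letters M"
    "r (start M) \<in> r ` states M" "r ` accepting M \<subseteq> r ` states M"
    by auto
  \<comment> \<open>the four projections of \<open>closed\<close> are the four closure conditions\<close>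
  show ?thesis
    unfolding pf_tm_def tape_symbols_rename_tm fields
    by (intro conjI basic ballI allI impI; elim closed[THEN conjunct1]
        closed[THEN conjunct2, THEN conjunct1] closed[THEN conjunct2, THEN conjunct2, THEN conjunct1]
        closed[THEN conjunct2, THEN conjunct2, THEN conjunct2, THEN mp])
qed

text \<open>
  The decoding inside \<^const>\<open>rename_tm\<close> is an inverse only on the declared states and tape symbols, so
  the simulation is confined to configurations made of these; \<^const>\<open>pf_tm\<close> keeps a run among them.
\<close>

lemma tm_step_rename_tm:
  assumes "well_formed M c"
  shows "tm_step (rename_tm r e M) (rename_config r e c) = map_option (rename_config r e) (tm_step M c)"
proof -
  obtain q p t where c: "c = (q, p, t)" by (metis prod_cases3)
  then have "q \<in> states M" "t p \<in> tape_symbols M" using assms by auto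
  then show ?thesis
    by (auto simp: c delta_rename_tm split: option.splits)
qed

lemma well_formed_tm_step:
  assumes "well_formed M c" "tm_step M c = Some c'"
  shows "well_formed M c'"
proof -
  obtain q p t where c: "c = (q, p, t)" by (metis prod_cases3)
  then have wf: "q \<in> states M" "range t \<subseteq> tape_symbols M" "t p \<in> tape_symbols M"
    using assms by auto
  obtain q' a d where d: "delta M q (t p) = Some (q', a, d)" "c' = (q', move_head d p, t(p := a))"
    using assms(2) by (auto simp: c split: option.splits)
  show ?thesis
    using pf_tmD(1,2)[OF pf wf(1,3) d(1)] wf(2) by (auto simp: d(2))
qed

lemma run_rename_tm:
  assumes "(c, c') \<in> transition M ^^ k" "well_formed M c"
  shows "well_formed M c' \<and>
    (rename_config r e c, rename_config r e c') \<in> transition (rename_tm r e M) ^^ k"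
  using assms
proof (induction k arbitrary: c')
  case (Suc k)
  then obtain d where d: "(c, d) \<in> transition M ^^ k" "tm_step M d = Some c'"
    by (auto simp: transition_def)
  then have "well_formed M d"
    "(rename_config r e c, rename_config r e d) \<in> transition (rename_tm r e M) ^^ k"
    using Suc by auto
  moreover from this have "(rename_config r e d, rename_config r e c') \<in> transition (rename_tm r e M)"
    using d by (simp add: transition_def tm_step_rename_tm)
  ultimately show ?case
    using well_formed_tm_step d(2) by auto
qed simp

lemma accepts_rename_tm:
  assumes acc: "accepts_with_output_in M x y k" and x: "x \<in> lists \<Sigma>"
  shows "accepts_with_output_in (rename_tm r e M) (map e x) (map e y) k"
proof -
  obtain q p t where run: "(initial_config M x, (q, p, t)) \<in> transition M ^^ k"
    and halt: "tm_step M (q, p, t) = None" and q: "q \<in> accepting M"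
    and out: "map t [0..<length y + 2] = Marker # map Letter y @ [Blank]"
    using acc unfolding accepts_with_output_in_def by (elim exE conjE) (rule that)
  have "x \<in> lists (work_letters M)" "start M \<in> states M"
    using x pf by (auto simp: pf_tm_def)
  then have "well_formed M (initial_config M x)"
    by (auto simp: initial_config_def initial_tape_def tape_symbols_def in_lists_conv_set)
  from run_rename_tm[OF run this] have wf: "well_formed M (q, p, t)" and
    run': "(rename_config r e (initial_config M x), rename_config r e (q, p, t))
      \<in> transition (rename_tm r e M) ^^ k"
    by auto
  have init: "rename_config r e (initial_config M x) = initial_config (rename_tm r e M) (map e x)"
    by (auto simp: initial_config_def initial_tape_def rename_tm_def fun_eq_iff)
  have halt': "tm_step (rename_tm r e M) (rename_config r e (q, p, t)) = None"
    using tm_step_rename_tm[OF wf] halt by simp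
  have q': "r q \<in> accepting (rename_tm r e M)"
    using q by (simp add: rename_tm_def)
  have "map (\<lambda>i. map_symbol e (t i)) [0..<length y + 2] = map (map_symbol e) (map t [0..<length y + 2])"
    by (simp only: map_map o_def)
  also have "\<dots> = Marker # map Letter (map e y) @ [Blank]"
    unfolding out by simp
  finally have out': "map (\<lambda>i. map_symbol e (t i)) [0..<length (map e y) + 2] = \<dots>"
    by (simp only: length_map)
  show ?thesis
    unfolding accepts_with_output_in_def
    by (intro exI conjI) (rule run'[unfolded init rename_config.simps] halt'[unfolded rename_config.simps] q' out')+
qed

end

text \<open>
  The encoding \<open>e\<close> of the letters is chosen by the caller, because all generators have to act on words
  over one common alphabet. The states are private to each machine and are numbered here.
\<close>

lemma pf_linear_time_computable_rename:
  fixes M :: "('q, 'a) tm" and e :: "'a \<Rightarrow> nat"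
  assumes pf: "pf_tm \<Sigma> M" and inj_e: "inj_on e (work_letters M)"
    and f: "f ` lists \<Sigma> \<subseteq> lists \<Sigma>"
    and run: "\<And>x. x \<in> lists \<Sigma> \<Longrightarrow> \<exists>k \<le> C * (length x + 1). accepts_with_output_in M x (f x) k"
  shows "pf_linear_time_computable (e ` \<Sigma>) (\<lambda>w. map e (f (map (inv_into \<Sigma> e) w)))"
proof -
  have "finite (states M)" using pf by (simp add: pf_tm_def)
  then obtain r :: "'q \<Rightarrow> nat" where inj_r: "inj_on r (states M)"
    using finite_imp_inj_to_nat_seg by blast
  have inj_\<Sigma>: "inj_on e \<Sigma>"
    using pf inj_e by (auto simp: pf_tm_def intro: inj_on_subset)
  have decode: "map (inv_into \<Sigma> e) w \<in> lists \<Sigma>" "map e (map (inv_into \<Sigma> e) w) = w"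
    if "w \<in> lists (e ` \<Sigma>)" for w
  proof -
    show "map (inv_into \<Sigma> e) w \<in> lists \<Sigma>"
      using that by (auto simp: in_lists_conv_set intro: inv_into_into)
    show "map e (map (inv_into \<Sigma> e) w) = w"
      using that by (auto simp: in_lists_conv_set f_inv_into_f intro!: map_idI)
  qed
  have "\<exists>k \<le> C * (length w + 1).
      accepts_with_output_in (rename_tm r e M) w (map e (f (map (inv_into \<Sigma> e) w))) k"
    if "w \<in> lists (e ` \<Sigma>)" for w
    using run[OF decode(1)[OF that]] accepts_rename_tm[OF pf inj_r inj_e _ decode(1)[OF that]]
      decode(2)[OF that] by (metis length_map)
  moreover have "map e (f (map (inv_into \<Sigma> e) w)) \<in> lists (e ` \<Sigma>)" if "w \<in> lists (e ` \<Sigma>)" for w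
  proof -
    have "f (map (inv_into \<Sigma> e) w) \<in> lists \<Sigma>"
      using f decode(1)[OF that] by (rule image_subset_iff[THEN iffD1, THEN bspec])
    then show ?thesis by (auto simp: in_lists_conv_set)
  qed
  ultimately show ?thesis
    unfolding pf_linear_time_computable_def
    using pf_tm_rename_tm[OF pf inj_r inj_e] by blast
qed

section \<open>Tapes holding a single word\<close>

text \<open>
  A tape of this form with the head next to a split point of the word is an ordinary zipper, and each
  of the machine's moves is one of these equations.
\<close>

lemma initial_tape_simps:
  "initial_tape x 0 = Marker" "(initial_tape x)(0 := Marker) = initial_tape x"
  "initial_tape x (Suc (length x)) = Blank" "(initial_tape x)(Suc (length x) := Blank) = initial_tape x"
  "(initial_tape x)(Suc (length x) := Letter c) = initial_tape (x @ [c])"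
  "initial_tape (x @ a # y) (Suc (length x)) = Letter a"
  "(initial_tape (x @ a # y))(Suc (length x) := Letter c) = initial_tape (x @ c # y)"
  "(initial_tape (x @ [a]))(Suc (length x) := Blank) = initial_tape x"
  by (auto simp: initial_tape_def fun_eq_iff nth_append nth_Cons split: nat.splits)

lemma step_then_run:
  assumes "tm_step M c = Some c'" "(c', c'') \<in> transition M ^^ k"
  shows "(c, c'') \<in> transition M ^^ Suc k"
  using assms by (intro relpow_Suc_I2[of _ c']) (auto simp: transition_def)

lemma run_then_step:
  assumes "(c, c') \<in> transition M ^^ k" "tm_step M c' = Some c''"
  shows "(c, c'') \<in> transition M ^^ Suc k"
  using assms by (intro relpow_Suc_I[of _ c']) (auto simp: transition_def)

lemma initial_tape_output:
  "map (initial_tape y) [0..<length y + 2] = Marker # map Letter y @ [Blank]"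
proof (rule nth_equalityI)
  fix i assume "i < length (map (initial_tape y) [0..<length y + 2])"
  then show "map (initial_tape y) [0..<length y + 2] ! i = (Marker # map Letter y @ [Blank]) ! i"
    by (auto simp: initial_tape_def nth_Cons nth_append simp del: upt_Suc split: nat.splits)
qed simp

section \<open>Words as matrices\<close>

text \<open>
  An array holds one digit (or one carry) for each of the \<open>n \<times> n\<close> entries of a matrix. The tape is
  folded at the radix point: the column in cell \<open>i \<ge> 1\<close> carries in its first component the digits of
  weight \<open>b ^ (i - 1)\<close> and in its second those of weight \<open>b ^ - i\<close>. Both ends of every numeral lie
  at the right end of the word, where growing and shrinking are local operations.
\<close>

type_synonym array = "nat \<times> nat \<Rightarrow> int"
type_synonym column = "array \<times> array"

abbreviation zero_array :: array where "zero_array \<equiv> \<lambda>_. 0"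

definition zero_column :: column where "zero_column = (zero_array, zero_array)"

abbreviation trim :: "column list \<Rightarrow> column list" where
  "trim \<equiv> strip_while (\<lambda>a. a = zero_column)"

locale positional =
  fixes n :: nat and b :: int
  assumes b: "3 \<le> b"
begin

text \<open>
  The entries outside \<open>{..<n} \<times> {..<n}\<close> are pinned to zero, which makes this a finite set and lets
  equality of functions mean equality of arrays.
\<close>

definition arrays :: "int set \<Rightarrow> array set" where
  "arrays B = {Z. \<forall>ij. (ij \<in> {..<n} \<times> {..<n} \<longrightarrow> Z ij \<in> B) \<and> (ij \<notin> {..<n} \<times> {..<n} \<longrightarrow> Z ij = 0)}"

text \<open>
  Since \<open>-1\<close> is a digit, every integer, negative ones included, has a finite expansion, so no signs
  have to be stored. Dividing with remainder in this range strictly decreases the absolute value of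
  any nonzero integer, because \<open>b \<ge> 3\<close>.
\<close>

abbreviation digits :: "int set" where "digits \<equiv> {-1..b - 2}"

definition columns :: "column set" where "columns = arrays digits \<times> arrays digits"

lemma finite_arrays: "finite B \<Longrightarrow> finite (arrays B)"
  unfolding arrays_def by (rule finite_set_of_finite_funs) auto

lemma arrays_entry: "Z \<in> arrays B \<Longrightarrow> 0 \<in> B \<Longrightarrow> Z ij \<in> B"
  unfolding arrays_def by (cases "ij \<in> {..<n} \<times> {..<n}") (auto simp del: split_paired_All)

lemma arrays_outside: "Z \<in> arrays B \<Longrightarrow> ij \<notin> {..<n} \<times> {..<n} \<Longrightarrow> Z ij = 0"
  unfolding arrays_def by blast

lemma zero_in_arrays: "0 \<in> B \<Longrightarrow> zero_array \<in> arrays B"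
  by (simp add: arrays_def)

lemma digit_entry: "Z \<in> arrays digits \<Longrightarrow> Z ij \<in> digits"
  by (rule arrays_entry) (use b in auto)

lemma zero_digits: "zero_array \<in> arrays digits"
  using b by (intro zero_in_arrays) auto

lemma zero_column_in: "zero_column \<in> columns"
  by (simp add: columns_def zero_column_def zero_digits)

text \<open>
  The two tracks of the entry \<open>ij\<close>, evaluated by Horner's rule. The value of the fractional track may
  be negative, so \<open>ival\<close> need not be the floor of the entry.
\<close>

fun ival :: "column list \<Rightarrow> nat \<times> nat \<Rightarrow> int" where
  "ival [] ij = 0"
| "ival ((I, F) # x) ij = I ij + b * ival x ij"

fun fval :: "column list \<Rightarrow> nat \<times> nat \<Rightarrow> rat" where
  "fval [] ij = 0"
| "fval ((I, F) # x) ij = (of_int (F ij) + fval x ij) / of_int b"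

definition matrix_of :: "column list \<Rightarrow> rat mat" where
  "matrix_of x = mat n n (\<lambda>ij. of_int (ival x ij) + fval x ij)"

lemma matrix_of_carrier [simp]: "matrix_of x \<in> carrier_mat n n"
  by (simp add: matrix_of_def)

text \<open>
  The bounds are those of the constant infinite expansions with digit \<open>-1\<close> and \<open>b - 2\<close>. They are
  strict because a word is finite, and they are exactly one apart, so a fractional part never
  reaches into the integer part.
\<close>

lemma fval_bounds:
  assumes "x \<in> lists columns"
  shows "-1 < (of_int b - 1) * fval x ij \<and> (of_int b - 1) * fval x ij < of_int b - 2"
  using assms
proof (induction x)
  case Nil
  have "(3::rat) \<le> of_int b" using b by (metis of_int_le_iff of_int_numeral)
  then show ?case by simp
next
  case (Cons a x)
  obtain I F where a: "a = (I, F)" by fastforce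
  define \<beta> where "\<beta> = (of_int b :: rat)"
  have \<beta>: "3 \<le> \<beta>" unfolding \<beta>_def using b by (metis of_int_le_iff of_int_numeral)
  have "F \<in> arrays digits" using Cons.hyps a by (auto simp: columns_def)
  then have "F ij \<in> digits" by (rule digit_entry)
  then have "- 1 \<le> F ij" "F ij \<le> b - 2" by auto
  then have "of_int (-1) \<le> (of_int (F ij) :: rat)" "of_int (F ij) \<le> (of_int (b - 2) :: rat)"
    by (simp_all only: of_int_le_iff)
  then have F: "- 1 \<le> (of_int (F ij) :: rat)" "of_int (F ij) \<le> \<beta> - 2"
    by (simp_all add: \<beta>_def)
  have *: "- 1 < (\<beta> - 1) * fval x ij" "(\<beta> - 1) * fval x ij < \<beta> - 2"
    using Cons \<beta>_def by auto
  have "(\<beta> - 1) * - 1 \<le> (\<beta> - 1) * of_int (F ij)" "(\<beta> - 1) * of_int (F ij) \<le> (\<beta> - 1) * (\<beta> - 2)"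
    using \<beta> by (intro mult_left_mono[OF F(1)] mult_left_mono[OF F(2)]; simp)+
  with * have "- \<beta> < (\<beta> - 1) * (of_int (F ij) + fval x ij)"
    "(\<beta> - 1) * (of_int (F ij) + fval x ij) < (\<beta> - 2) * \<beta>"
    by (simp_all add: algebra_simps)
  then show ?case
    using \<beta> unfolding a \<beta>_def[symmetric] fval.simps
    by (simp add: less_divide_eq divide_less_eq)
qed

lemma fval_diff_less_1:
  assumes "x \<in> lists columns" "y \<in> lists columns"
  shows "\<bar>fval x ij - fval y ij\<bar> < 1"
proof -
  define \<beta> where "\<beta> = (of_int b :: rat)"
  have \<beta>: "3 \<le> \<beta>" unfolding \<beta>_def using b by (metis of_int_le_iff of_int_numeral)
  have "(\<beta> - 1) * (fval x ij - fval y ij) < (\<beta> - 1) * 1"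
    "(\<beta> - 1) * (fval y ij - fval x ij) < (\<beta> - 1) * 1"
    using fval_bounds[OF assms(1), of ij] fval_bounds[OF assms(2), of ij] 
    unfolding \<beta>_def[symmetric] by (simp_all add: algebra_simps)
  then show ?thesis using \<beta> by (simp add: abs_less_iff)
qed

lemma int_part_unique:
  assumes "x \<in> lists columns" "y \<in> lists columns"
    and "of_int k + fval x ij = of_int l + fval y ij"
  shows "k = l" "fval x ij = fval y ij"
proof -
  have "\<bar>of_int (k - l) :: rat\<bar> < 1"
    using fval_diff_less_1[OF assms(2,1), of ij] assms(3) by (simp add: algebra_simps)
  then have "of_int \<bar>k - l\<bar> < (of_int 1 :: rat)" by simp
  then have "\<bar>k - l\<bar> < 1" by (simp only: of_int_less_iff)
  then show "k = l" by simp
  then show "fval x ij = fval y ij" using assms(3) by simp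
qed

lemma digit_unique:
  assumes "d \<in> digits" "d' \<in> digits" "d + b * k = d' + b * l"
  shows "d = d'" "k = l"
proof -
  have "(d + 1) mod b = d + 1" "(d' + 1) mod b = d' + 1"
    using assms by (auto intro!: mod_pos_pos_trivial)
  moreover have "(d + 1 + b * k) mod b = (d' + 1 + b * l) mod b"
    using assms(3) by (metis add.assoc add.commute)
  ultimately show "d = d'" by simp
  then show "k = l" using assms(3) b by simp
qed

lemma words_of_equal_length_unique:
  assumes "length x = length y" "x \<in> lists columns" "y \<in> lists columns"
    and "\<And>ij. ival x ij = ival y ij" "\<And>ij. fval x ij = fval y ij"
  shows "x = y"
  using assms
proof (induction x y rule: list_induct2)
  case (Cons a x c y)
  obtain I F I' F' where a: "a = (I, F)" "c = (I', F')" by fastforce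
  have b0: "(of_int b :: rat) \<noteq> 0" using b by simp
  have mem: "I \<in> arrays digits" "I' \<in> arrays digits" "x \<in> lists columns" "y \<in> lists columns"
    using Cons.prems a by (auto simp: columns_def)
  have i: "I ij = I' ij" "ival x ij = ival y ij" for ij
    using digit_unique[of "I ij" "I' ij" "ival x ij" "ival y ij"] digit_entry mem Cons.prems(3)[of ij]
    by (auto simp: a)
  have f: "F ij = F' ij" "fval x ij = fval y ij" for ij
  proof -
    have "of_int (F ij) + fval x ij = of_int (F' ij) + fval y ij"
      using Cons.prems(4)[of ij] b0 by (simp add: a)
    from int_part_unique[OF mem(3,4) this] show "F ij = F' ij" "fval x ij = fval y ij" .
  qed
  show ?case
    using Cons.IH[OF mem(3,4) i(2) f(2)] i(1) f(1) by (auto simp: a)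
qed simp

lemma val_append_zeros:
  "ival (x @ replicate k zero_column) ij = ival x ij"
  "fval (x @ replicate k zero_column) ij = fval x ij"
proof -
  have "ival (replicate k zero_column) ij = 0" "fval (replicate k zero_column) ij = 0"
    by (induction k) (auto simp: zero_column_def)
  then show "ival (x @ replicate k zero_column) ij = ival x ij"
    "fval (x @ replicate k zero_column) ij = fval x ij"
    by (induction x) auto
qed

lemma trim_append_zeros: "trim (x @ replicate k zero_column) = trim x"
proof (induction k)
  case (Suc k)
  have "x @ replicate (Suc k) zero_column = (x @ replicate k zero_column) @ [zero_column]"
    by (simp add: replicate_append_same)
  then show ?case using Suc by (simp only: strip_while_snoc if_True simp_thms)
qed simp

lemma trim_decomposition: "\<exists>k. x = trim x @ replicate k zero_column"
proof -
  obtain zs where zs: "\<forall>a\<in>set zs. a = zero_column" "x = trim x @ zs"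
    by (rule split_strip_while_append[of "\<lambda>a. a = zero_column" x]) blast
  then have "zs = replicate (length zs) zero_column"
    by (intro replicate_eqI) auto
  with zs(2) show ?thesis by metis
qed

lemma matrix_of_trim: "matrix_of (trim x) = matrix_of x"
proof -
  obtain k where k: "x = trim x @ replicate k zero_column"
    using trim_decomposition by blast
  have "ival x = ival (trim x)" "fval x = fval (trim x)"
    using val_append_zeros[of "trim x" k] by (simp_all add: fun_eq_iff flip: k)
  then show ?thesis by (simp add: matrix_of_def)
qed

lemma trim_in_lists: "x \<in> lists columns \<Longrightarrow> trim x \<in> lists columns"
  by (auto simp: in_lists_conv_set strip_while_def dest: set_dropWhileD)

lemma val_outside:
  assumes "x \<in> lists columns" "ij \<notin> {..<n} \<times> {..<n}"
  shows "ival x ij = 0" "fval x ij = 0"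
proof -
  have "ival x ij = 0 \<and> fval x ij = 0"
    using assms by (induction x) (auto simp: columns_def arrays_outside simp del: mem_Sigma_iff)
  then show "ival x ij = 0" "fval x ij = 0" by auto
qed

text \<open>
  Expansions are unique up to trailing zero columns: padding two words to the same length makes
  them equal digit by digit. Hence trimmed words are normal forms for the matrices they denote.
\<close>

theorem trim_eqI:
  assumes x: "x \<in> lists columns" and y: "y \<in> lists columns" and eq: "matrix_of x = matrix_of y"
  shows "trim x = trim y"
proof -
  let ?x = "x @ replicate (length y) zero_column"
  let ?y = "y @ replicate (length x) zero_column"
  have same: "ival x ij = ival y ij \<and> fval x ij = fval y ij" for ij
  proof (cases "ij \<in> {..<n} \<times> {..<n}")
    case True
    then have "of_int (ival x ij) + fval x ij = matrix_of x $$ ij"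
      "of_int (ival y ij) + fval y ij = matrix_of y $$ ij"
      by (auto simp: matrix_of_def)
    then show ?thesis using int_part_unique[OF x y] eq by metis
  qed (simp add: val_outside x y)
  have "?x = ?y"
    using x y same zero_column_in
    by (intro words_of_equal_length_unique) (auto simp: val_append_zeros)
  then show ?thesis by (metis trim_append_zeros)
qed

section \<open>Digits and carries\<close>

definition digit :: "int \<Rightarrow> int" where "digit z = (z + 1) mod b - 1"
definition carry :: "int \<Rightarrow> int" where "carry z = (z + 1) div b"

lemma digit_carry: "digit z + b * carry z = z"
  by (simp add: digit_def carry_def algebra_simps)

lemma digit_in: "digit z \<in> digits"
proof -
  have "0 \<le> (z + 1) mod b" "(z + 1) mod b < b" using b by simp_all
  then show ?thesis unfolding digit_def by simp
qed

lemma digit_0 [simp]: "digit 0 = 0" and carry_0 [simp]: "carry 0 = 0"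
  using b by (simp_all add: digit_def carry_def)

text \<open>
  The factor 3 comes from \<open>b \<ge> 3\<close>. It makes carries a contraction, which keeps the set of carries
  finite and makes a final carry die out after boundedly many cells.
\<close>

lemma carry_bound: "3 * \<bar>carry z\<bar> \<le> \<bar>z\<bar> + 1"
proof -
  have d: "-1 \<le> z - b * carry z" "z - b * carry z \<le> b - 2"
    using digit_in[of z] digit_carry[of z] by auto
  consider "carry z \<ge> 0" | "carry z < 0" by linarith
  then show ?thesis
  proof cases
    case 1
    then have "3 * carry z \<le> b * carry z" using b by (intro mult_right_mono) auto
    then show ?thesis using d 1 by linarith
  next
    case 2
    then have "3 * (- carry z - 1) \<le> b * (- carry z - 1)" using b by (intro mult_right_mono) auto
    then show ?thesis using d 2 by (simp add: algebra_simps)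
  qed
qed

lemma carry_decreases: "z \<noteq> 0 \<Longrightarrow> \<bar>carry z\<bar> \<le> \<bar>z\<bar> - 1"
  using carry_bound[of z] by linarith

end

section \<open>A machine that multiplies by a fixed matrix\<close>

text \<open>
  The machine multiplies by the rational matrix \<open>C / b\<close>, where \<open>C\<close> is integral, in four sweeps. Going
  right, it divides by \<open>b\<close> on the fractional track, moving every digit one cell away from the radix
  point; \<open>Shift G\<close> remembers the array \<open>G\<close> taken from the previous cell, and the array of units
  enters the fractional track in cell 1. Going left, \<open>Back q J\<close> moves the integer track one cell towards the
  radix point, \<open>J\<close> being the array met in the previous cell, and multiplies the fractional track by \<open>C\<close>
  with carry \<open>q\<close>, least significant digit first. At the marker the carry passes over to the integer
  track, which \<open>Fwd q\<close> processes going right. Finally \<open>Trim\<close> erases trailing zero columns.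
\<close>

datatype phase = Start | First | Shift array | Back array array | Fwd array | Trim

locale multiplier = positional +
  fixes C :: "nat \<times> nat \<Rightarrow> int"
begin

definition mul_array :: "array \<Rightarrow> array" where
  "mul_array Z = (\<lambda>(i, j). if i < n \<and> j < n then \<Sum>k<n. Z (i, k) * C (k, j) else 0)"

definition next_carry :: "array \<Rightarrow> array \<Rightarrow> array" where
  "next_carry q Z = (\<lambda>ij. carry (mul_array Z ij + q ij))"

definition next_digit :: "array \<Rightarrow> array \<Rightarrow> array" where
  "next_digit q Z = (\<lambda>ij. digit (mul_array Z ij + q ij))"

text \<open>
  A digit array times \<open>C\<close> has entries of absolute value at most \<open>cbound - 1\<close>. If the incoming
  carry is at most \<open>cbound\<close>, the outgoing one is at most \<open>(2 * cbound) / 3\<close> by \<open>carry_bound\<close>.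
\<close>

definition cbound :: int where
  "cbound = b * (\<Sum>kj\<in>{..<n} \<times> {..<n}. \<bar>C kj\<bar>) + 1"

abbreviation carries :: "int set" where "carries \<equiv> {-cbound..cbound}"

lemma digit_carry_step:
  "next_digit q Z ij + b * next_carry q Z ij = mul_array Z ij + q ij"
  by (simp add: next_digit_def next_carry_def digit_carry)

lemma mul_array_zero [simp]: "mul_array zero_array ij = 0"
  by (simp add: mul_array_def split: prod.splits)

lemma cbound_pos: "1 \<le> cbound"
  using b by (simp add: cbound_def sum_nonneg)

lemma mul_array_bound:
  assumes "Z \<in> arrays digits"
  shows "\<bar>mul_array Z ij\<bar> \<le> cbound - 1"
proof (cases "ij \<in> {..<n} \<times> {..<n}")
  case False
  then show ?thesis using cbound_pos by (auto simp: mul_array_def split: prod.splits)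
next
  case True
  then obtain i j where ij: "ij = (i, j)" "i < n" "j < n" by auto
  have Z: "\<bar>Z kl\<bar> \<le> b" for kl
    using digit_entry[OF assms, of kl] b by auto
  have "\<bar>mul_array Z ij\<bar> \<le> (\<Sum>k<n. \<bar>Z (i, k) * C (k, j)\<bar>)"
    using ij by (simp add: mul_array_def sum_abs)
  also have "\<dots> \<le> (\<Sum>k<n. b * \<bar>C (k, j)\<bar>)"
    by (intro sum_mono) (simp add: abs_mult mult_right_mono Z)
  also have "\<dots> = b * (\<Sum>kj\<in>(\<lambda>k. (k, j)) ` {..<n}. \<bar>C kj\<bar>)"
    by (simp add: sum_distrib_left sum.reindex inj_on_def)
  also have "\<dots> \<le> b * (\<Sum>kj\<in>{..<n} \<times> {..<n}. \<bar>C kj\<bar>)"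
    using b ij by (intro mult_left_mono sum_mono2) auto
  finally show ?thesis by (simp add: cbound_def)
qed

lemma next_carry_in:
  assumes "q \<in> arrays carries" "Z \<in> arrays digits"
  shows "next_carry q Z \<in> arrays carries"
proof -
  have q: "\<bar>q ij\<bar> \<le> cbound" for ij
    using arrays_entry[OF assms(1), of ij] cbound_pos by auto
  have bound: "\<bar>next_carry q Z ij\<bar> \<le> cbound" for ij
    using carry_bound[of "mul_array Z ij + q ij"] q[of ij] mul_array_bound[OF assms(2), of ij] cbound_pos
    unfolding next_carry_def by linarith
  have "next_carry q Z ij \<in> carries" for ij
    using bound[of ij] by (simp add: abs_le_iff)
  moreover have "next_carry q Z ij = 0" if "ij \<notin> {..<n} \<times> {..<n}" for ij
    using arrays_outside[OF assms(1) that] that by (cases ij) (auto simp: next_carry_def mul_array_def)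
  ultimately show ?thesis by (simp add: arrays_def)
qed

lemma next_digit_in:
  assumes "q \<in> arrays carries"
  shows "next_digit q Z \<in> arrays digits"
proof -
  have "next_digit q Z ij = 0" if "ij \<notin> {..<n} \<times> {..<n}" for ij
    using arrays_outside[OF assms that] that by (cases ij) (auto simp: next_digit_def mul_array_def)
  then show ?thesis using digit_in by (simp add: arrays_def next_digit_def)
qed

lemma zero_carries: "zero_array \<in> arrays carries"
  using cbound_pos by (intro zero_in_arrays) auto

fun mul_delta :: "phase \<Rightarrow> column symbol \<Rightarrow> (phase \<times> column symbol \<times> direction) option" where
  "mul_delta Start Marker = Some (First, Marker, Move_Right)"
| "mul_delta First (Letter (I, F)) = Some (Shift F, Letter (I, I), Move_Right)"
| "mul_delta First Blank =
     Some (Back zero_array zero_array, Letter (zero_array, zero_array), Stay)"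
| "mul_delta (Shift G) (Letter (I, F)) = Some (Shift F, Letter (I, G), Move_Right)"
| "mul_delta (Shift G) Blank =
     Some (Back zero_array zero_array, Letter (zero_array, G), Stay)"
| "mul_delta (Back q J) (Letter (I, F)) =
     Some (Back (next_carry q F) I, Letter (J, next_digit q F), Move_Left)"
| "mul_delta (Back q J) Marker = Some (Fwd q, Marker, Move_Right)"
| "mul_delta (Fwd q) (Letter (I, F)) =
     Some (Fwd (next_carry q I), Letter (next_digit q I, F), Move_Right)"
| "mul_delta (Fwd q) Blank =
     (if q = zero_array then Some (Trim, Blank, Move_Left)
      else Some (Fwd (next_carry q zero_array), Letter (next_digit q zero_array, zero_array),
             Move_Right))"
| "mul_delta Trim (Letter a) =
     (if a = zero_column then Some (Trim, Blank, Move_Left) else None)"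
| "mul_delta _ _ = None"

definition mul_tm :: "(phase, column) tm" where
  "mul_tm =
     \<lparr>states = {Start, First, Trim} \<union> Shift ` arrays digits \<union> Fwd ` arrays carries \<union>
        (\<lambda>(q, J). Back q J) ` (arrays carries \<times> arrays digits),
      work_letters = columns, start = Start, accepting = {Trim}, delta = mul_delta\<rparr>"

lemma pf_mul_tm: "pf_tm columns mul_tm"
proof -
  have closed: "q' \<in> states mul_tm \<and> c \<in> tape_symbols mul_tm \<and>
      (c = Marker \<longleftrightarrow> a = Marker) \<and> (a = Marker \<longrightarrow> d \<noteq> Move_Left)"
    if "q \<in> states mul_tm" "a \<in> tape_symbols mul_tm" "mul_delta q a = Some (q', c, d)" for q a q' c d
    using that zero_digits zero_carries
    by (cases "(q, a)" rule: mul_delta.cases)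
      (auto simp: mul_tm_def tape_symbols_def columns_def next_carry_in next_digit_in zero_column_def
        split: if_splits)
  have "finite (arrays digits)" "finite (arrays carries)" by (simp_all add: finite_arrays)
  then have "finite (states mul_tm)" "finite (work_letters mul_tm)" "columns \<subseteq> work_letters mul_tm"
    "start mul_tm \<in> states mul_tm" "accepting mul_tm \<subseteq> states mul_tm" and delta: "delta mul_tm = mul_delta"
    by (auto simp: mul_tm_def columns_def)
  then show ?thesis
    unfolding pf_tm_def delta using closed by blast
qed

text \<open>
  What the first three sweeps do to the word on the tape. The sweep to the left works from the last column
  on, hence \<open>norm_fracs\<close> also returns the carry and the buffered array with which the head
  leaves its first column.
\<close>

fun shift_fracs :: "array \<Rightarrow> column list \<Rightarrow> column list" where
  "shift_fracs G [] = [(zero_array, G)]"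
| "shift_fracs G ((I, F) # x) = (I, G) # shift_fracs F x"

fun norm_fracs :: "column list \<Rightarrow> array \<times> array \<times> column list" where
  "norm_fracs [] = (zero_array, zero_array, [])"
| "norm_fracs ((I, F) # x) =
     (let (q, J, y) = norm_fracs x in (next_carry q F, I, (J, next_digit q F) # y))"

text \<open>
  The last carry is written out behind the word. The first argument bounds the number of columns so
  that the recursion terminates; by \<open>carry_decreases\<close> a bound on the carry itself is large enough.
\<close>

fun flush :: "nat \<Rightarrow> array \<Rightarrow> column list" where
  "flush 0 q = []"
| "flush (Suc k) q =
     (if q = zero_array then []
      else (next_digit q zero_array, zero_array) # flush k (next_carry q zero_array))"

fun norm_ints :: "array \<Rightarrow> column list \<Rightarrow> column list" where
  "norm_ints q [] = flush (nat cbound) q"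
| "norm_ints q ((I, F) # x) = (next_digit q I, F) # norm_ints (next_carry q I) x"

definition unit_digits :: "column list \<Rightarrow> array" where
  "unit_digits x = (case x of [] \<Rightarrow> zero_array | a # _ \<Rightarrow> fst a)"

definition product :: "column list \<Rightarrow> column list" where
  "product x = trim (case norm_fracs (shift_fracs (unit_digits x) x) of (q, J, y) \<Rightarrow> norm_ints q y)"

lemma shift_in_lists:
  "x \<in> lists columns \<Longrightarrow> G \<in> arrays digits \<Longrightarrow> shift_fracs G x \<in> lists columns"
proof (induction x arbitrary: G)
  case Nil
  then show ?case by (simp add: columns_def zero_digits)
next
  case (Cons a x)
  then show ?case by (cases a) (auto simp: columns_def)
qed

lemma back_in:
  assumes "x \<in> lists columns" "norm_fracs x = (q, J, y)"
  shows "q \<in> arrays carries" "J \<in> arrays digits" "y \<in> lists columns" "length y = length x"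
proof -
  have "q \<in> arrays carries \<and> J \<in> arrays digits \<and> y \<in> lists columns \<and> length y = length x"
    using assms
  proof (induction x arbitrary: q J y)
    case Nil
    then show ?case using zero_carries zero_digits by auto
  next
    case (Cons a x)
    obtain q' J' y' where "norm_fracs x = (q', J', y')" by (metis prod_cases3)
    with Cons show ?case
      by (cases a) (auto simp: columns_def next_carry_in next_digit_in)
  qed
  then show "q \<in> arrays carries" "J \<in> arrays digits" "y \<in> lists columns" "length y = length x"
    by auto
qed

lemma flush_in_lists: "q \<in> arrays carries \<Longrightarrow> flush k q \<in> lists columns"
  by (induction k q rule: flush.induct) (auto simp: columns_def next_carry_in next_digit_in zero_digits)

lemma fwd_in_lists: "x \<in> lists columns \<Longrightarrow> q \<in> arrays carries \<Longrightarrow> norm_ints q x \<in> lists columns"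
proof (induction x arbitrary: q)
  case Nil
  then show ?case by (simp add: flush_in_lists)
next
  case (Cons a x)
  then show ?case by (cases a) (auto simp: columns_def next_carry_in next_digit_in)
qed

lemma unit_digits_in: "x \<in> lists columns \<Longrightarrow> unit_digits x \<in> arrays digits"
  by (cases x) (auto simp: unit_digits_def columns_def zero_digits)

lemma product_in_lists:
  assumes "x \<in> lists columns"
  shows "product x \<in> lists columns"
proof -
  obtain q J y where y: "norm_fracs (shift_fracs (unit_digits x) x) = (q, J, y)" by (metis prod_cases3)
  note back_in[OF shift_in_lists[OF assms unit_digits_in[OF assms]] y]
  then show ?thesis unfolding product_def y by (simp add: trim_in_lists fwd_in_lists)
qed

lemma val_shift:
  "ival (shift_fracs G x) ij = ival x ij"
  "fval (shift_fracs G x) ij = (of_int (G ij) + fval x ij) / of_int b"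
  by (induction G x rule: shift_fracs.induct) auto

text \<open>
  Removing the units \<open>J\<close> and dividing the rest by \<open>b\<close> is what moving the integer track does.
\<close>

lemma ival_back: "norm_fracs x = (q, J, y) \<Longrightarrow> ival x ij = J ij + b * ival y ij"
  by (induction x arbitrary: q J y rule: norm_fracs.induct) (auto split: prod.splits)

text \<open>
  The invariant of the sweep to the left: \<open>C\<close> times the fraction read so far is the fraction
  written so far, the carry being the amount by which it overflows.
\<close>

lemma fval_back:
  assumes "norm_fracs x = (q, J, y)" "i < n" "j < n"
  shows "of_int (q (i, j)) + fval y (i, j) = (\<Sum>k<n. fval x (i, k) * of_int (C (k, j)))"
  using assms(1)
proof (induction x arbitrary: q J y rule: norm_fracs.induct)
  case (2 I F x)
  obtain q' J' y' where x: "norm_fracs x = (q', J', y')" by (metis prod_cases3)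
  have y: "q = next_carry q' F" "y = (J', next_digit q' F) # y'"
    using 2(2) x by auto
  have b0: "(of_int b :: rat) \<noteq> 0" using b by simp
  have dc: "of_int (next_digit q' F (i, j)) + of_int b * of_int (next_carry q' F (i, j))
      = (of_int (mul_array F (i, j)) + of_int (q' (i, j)) :: rat)"
    using digit_carry_step[of q' F "(i, j)"] by (metis of_int_add of_int_mult)
  have "(of_int b :: rat) * (of_int (q (i, j)) + fval y (i, j)) =
      of_int (next_digit q' F (i, j)) + of_int b * of_int (next_carry q' F (i, j)) + fval y' (i, j)"
    using b0 by (simp add: y field_simps)
  also have "\<dots> = of_int (mul_array F (i, j)) + (of_int (q' (i, j)) + fval y' (i, j))"
    by (simp add: dc)
  also have "\<dots> = (\<Sum>k<n. of_int (F (i, k)) * of_int (C (k, j))) + (\<Sum>k<n. fval x (i, k) * of_int (C (k, j)))"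
    using 2(1)[OF x] assms(2,3) by (simp add: mul_array_def)
  also have "\<dots> = (\<Sum>k<n. (of_int (F (i, k)) + fval x (i, k)) * of_int (C (k, j)))"
    by (simp add: sum.distrib algebra_simps)
  also have "\<dots> = of_int b * (\<Sum>k<n. fval ((I, F) # x) (i, k) * of_int (C (k, j)))"
    using b0 by (simp add: sum_distrib_left)
  finally show ?case using b0 by simp
qed simp

lemma val_flush:
  assumes "\<And>ij. \<bar>q ij\<bar> \<le> int k"
  shows "ival (flush k q) ij = q ij" "fval (flush k q) ij = 0"
proof -
  have "ival (flush k q) ij = q ij \<and> fval (flush k q) ij = 0"
    using assms
  proof (induction k q rule: flush.induct)
    case (2 k q)
    show ?case
    proof (cases "q = zero_array")
      case False
      have "\<bar>next_carry q zero_array ij\<bar> \<le> int k" for ij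
        using carry_decreases[of "q ij"] 2(2)[of ij] by (cases "q ij = 0") (auto simp: next_carry_def)
      then show ?thesis
        using 2(1)[OF False] False digit_carry_step[of q zero_array ij] by simp
    qed simp
  qed simp
  then show "ival (flush k q) ij = q ij" "fval (flush k q) ij = 0" by auto
qed

lemma fval_fwd:
  assumes "q \<in> arrays carries" "x \<in> lists columns"
  shows "fval (norm_ints q x) ij = fval x ij"
  using assms(2,1)
proof (induction x arbitrary: q)
  case Nil
  then have "\<bar>q kl\<bar> \<le> int (nat cbound)" for kl
    using arrays_entry[of q carries kl] cbound_pos by (auto simp: abs_le_iff)
  then show ?case by (simp add: val_flush)
next
  case (Cons a x)
  then show ?case by (cases a) (auto simp: columns_def next_carry_in)
qed

lemma ival_fwd:
  assumes "q \<in> arrays carries" "x \<in> lists columns" and ij: "i < n" "j < n"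
  shows "ival (norm_ints q x) (i, j) = q (i, j) + (\<Sum>k<n. ival x (i, k) * C (k, j))"
  using assms(2,1)
proof (induction x arbitrary: q)
  case Nil
  then have "\<bar>q kl\<bar> \<le> int (nat cbound)" for kl
    using arrays_entry[of q carries kl] cbound_pos by (auto simp: abs_le_iff)
  then show ?case by (simp add: val_flush)
next
  case (Cons a x)
  obtain I F where a: "a = (I, F)" by fastforce
  then have I: "I \<in> arrays digits" using Cons.hyps by (simp add: columns_def)
  have "ival (norm_ints q (a # x)) (i, j) = next_digit q I (i, j) + b * next_carry q I (i, j)
      + b * (\<Sum>k<n. ival x (i, k) * C (k, j))"
    using Cons.IH[OF next_carry_in[OF Cons.prems I]] by (simp add: a algebra_simps)
  also have "\<dots> = q (i, j) + (\<Sum>k<n. (I (i, k) + b * ival x (i, k)) * C (k, j))"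
    using ij by (simp add: digit_carry_step mul_array_def sum.distrib sum_distrib_left algebra_simps)
  finally show ?case by (simp add: a)
qed

text \<open>
  The two shifts together divide by \<open>b\<close>, and the two normalisations multiply by \<open>C\<close>; the carry
  between them cancels.
\<close>

theorem matrix_of_product:
  assumes x: "x \<in> lists columns" and s: "s \<in> carrier_mat n n"
    and C: "\<And>i j. i < n \<Longrightarrow> j < n \<Longrightarrow> of_int b * s $$ (i, j) = of_int (C (i, j))"
  shows "matrix_of (product x) = matrix_of x * s"
proof -
  obtain q J y where y: "norm_fracs (shift_fracs (unit_digits x) x) = (q, J, y)" by (metis prod_cases3)
  note in_y = back_in[OF shift_in_lists[OF x unit_digits_in[OF x]] y]
  have J: "J = unit_digits x"
    using y by (cases x) (auto simp: unit_digits_def split: prod.splits)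
  have b0: "(of_int b :: rat) \<noteq> 0" using b by simp
  have shifted: "of_int (ival y ij) + fval (shift_fracs (unit_digits x) x) ij = (of_int (ival x ij) + fval x ij) / of_int b"
    for ij
    using ival_back[OF y, of ij] b0 by (simp add: val_shift J field_simps)
  have "of_int (ival (norm_ints q y) (i, j)) + fval (norm_ints q y) (i, j) =
      (\<Sum>k<n. (of_int (ival x (i, k)) + fval x (i, k)) * s $$ (k, j))" if ij: "i < n" "j < n" for i j
  proof -
    have "of_int (ival (norm_ints q y) (i, j)) + fval (norm_ints q y) (i, j) =
        (\<Sum>k<n. of_int (ival y (i, k)) * of_int (C (k, j))) + (of_int (q (i, j)) + fval y (i, j))"
      by (simp add: ival_fwd[OF in_y(1,3) ij] fval_fwd[OF in_y(1,3)])
    also have "\<dots> = (\<Sum>k<n. (of_int (ival y (i, k)) + fval (shift_fracs (unit_digits x) x) (i, k)) * of_int (C (k, j)))"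
      by (simp add: fval_back[OF y ij] sum.distrib algebra_simps)
    also have "\<dots> = (\<Sum>k<n. (of_int (ival x (i, k)) + fval x (i, k)) * s $$ (k, j))"
      using b0 ij by (intro sum.cong refl) (simp add: shifted flip: C)
    finally show ?thesis .
  qed
  then have "matrix_of (norm_ints q y) = matrix_of x * s"
    using s by (intro eq_matI) (auto simp: matrix_of_def scalar_prod_def lessThan_atLeast0)
  then show ?thesis by (simp add: product_def y matrix_of_trim)
qed

section \<open>The run of the machine\<close>

lemma delta_mul_tm [simp]: "delta mul_tm = mul_delta"
  by (simp add: mul_tm_def)

lemma run_shift:
  "((Shift G, Suc (length u), initial_tape (u @ x)),
    (Back zero_array zero_array, Suc (length u + length x), initial_tape (u @ shift_fracs G x)))
   \<in> transition mul_tm ^^ Suc (length x)"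
proof (induction G x arbitrary: u rule: shift_fracs.induct)
  case (1 G)
  show ?case by (intro step_then_run) (auto simp: initial_tape_simps)
next
  case (2 G I F x)
  show ?case
    using 2[of "u @ [(I, G)]"]
    by (intro step_then_run[where k = "length ((I, F) # x)"]) (auto simp: initial_tape_simps)
qed

lemma run_back:
  "norm_fracs x = (q, J, y) \<Longrightarrow>
   ((Back zero_array zero_array, length u + length x, initial_tape (u @ x)),
    (Back q J, length u, initial_tape (u @ y))) \<in> transition mul_tm ^^ length x"
proof (induction x arbitrary: u q J y rule: norm_fracs.induct)
  case (2 I F x)
  obtain q' J' y' where x: "norm_fracs x = (q', J', y')" by (metis prod_cases3)
  have "((Back zero_array zero_array, length u + length ((I, F) # x), initial_tape (u @ (I, F) # x)),
     (Back q' J', Suc (length u), initial_tape (u @ (I, F) # y'))) \<in> transition mul_tm ^^ length x"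
    using 2(1)[OF x, of "u @ [(I, F)]"] by simp
  from run_then_step[OF this] show ?case
    using 2(2) x by (auto simp: initial_tape_simps)
qed simp

text \<open>
  On blank cells the machine behaves as if it read zero columns, until the carry has vanished.
\<close>

lemma run_flush:
  assumes "\<And>ij. \<bar>q ij\<bar> \<le> int k"
  shows "((Fwd q, Suc (length u), initial_tape u),
     (Trim, length (u @ flush k q), initial_tape (u @ flush k q)))
   \<in> transition mul_tm ^^ Suc (length (flush k q))"
  using assms
proof (induction k q arbitrary: u rule: flush.induct)
  case (1 q)
  then have "q = zero_array" by (auto simp: fun_eq_iff)
  then show ?case by (intro step_then_run) (auto simp: initial_tape_simps)
next
  case (2 k q)
  show ?case
  proof (cases "q = zero_array")
    case True
    then show ?thesis by (intro step_then_run) (auto simp: initial_tape_simps)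
  next
    case False
    have "\<bar>next_carry q zero_array ij\<bar> \<le> int k" for ij
      using carry_decreases[of "q ij"] 2(2)[of ij] by (cases "q ij = 0") (auto simp: next_carry_def)
    from 2(1)[OF False this, of "u @ [(next_digit q zero_array, zero_array)]"] show ?thesis
      using False by (intro step_then_run[where k = "length (flush (Suc k) q)"])
        (auto simp: initial_tape_simps)
  qed
qed

lemma run_fwd:
  assumes "q \<in> arrays carries" "x \<in> lists columns"
  shows "((Fwd q, Suc (length u), initial_tape (u @ x)),
     (Trim, length (u @ norm_ints q x), initial_tape (u @ norm_ints q x)))
   \<in> transition mul_tm ^^ Suc (length (norm_ints q x))"
  using assms(2,1)
proof (induction x arbitrary: u q)
  case Nil
  then have "\<bar>q kl\<bar> \<le> int (nat cbound)" for kl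
    using arrays_entry[of q carries kl] cbound_pos by (auto simp: abs_le_iff)
  then show ?case using run_flush by simp
next
  case (Cons a x)
  obtain I F where a: "a = (I, F)" by fastforce
  then have "I \<in> arrays digits" using Cons.hyps by (simp add: columns_def)
  from Cons.IH[OF next_carry_in[OF Cons.prems this], of "u @ [(next_digit q I, F)]"] show ?case
    by (intro step_then_run[where k = "length (norm_ints q (a # x))"]) (auto simp: a initial_tape_simps)
qed

lemma run_trim:
  "\<exists>k \<le> length x. ((Trim, length x, initial_tape x), (Trim, length (trim x), initial_tape (trim x)))
     \<in> transition mul_tm ^^ k"
proof (induction x rule: rev_induct)
  case (snoc a x)
  show ?case
  proof (cases "a = zero_column")
    case True
    obtain k where k: "k \<le> length x" "((Trim, length x, initial_tape x),
        (Trim, length (trim x), initial_tape (trim x))) \<in> transition mul_tm ^^ k"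
      using snoc by blast
    have "((Trim, length (x @ [a]), initial_tape (x @ [a])),
        (Trim, length (trim x), initial_tape (trim x))) \<in> transition mul_tm ^^ Suc k"
      by (rule step_then_run[OF _ k(2)]) (simp add: initial_tape_simps True)
    with True k(1) show ?thesis by (intro exI[of _ "Suc k"]) auto
  next
    case False
    then show ?thesis by (intro exI[of _ 0]) auto
  qed
qed auto

lemma halted_trim: "tm_step mul_tm (Trim, length (trim x), initial_tape (trim x)) = None"
proof (cases "trim x" rule: rev_cases)
  case (snoc y a)
  then have "a \<noteq> zero_column"
    using no_trailing_strip_while[of "\<lambda>a. a = zero_column" x] by simp
  then show ?thesis by (simp add: snoc initial_tape_simps)
next
  case Nil
  show ?thesis unfolding Nil by (simp add: initial_tape_simps)
qed

lemma length_flush: "length (flush k q) \<le> k"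
  by (induction k q rule: flush.induct) auto

lemma length_fwd: "length (norm_ints q x) \<le> length x + nat cbound"
  by (induction q x rule: norm_ints.induct) (auto simp: length_flush)

lemma length_shift: "length (shift_fracs G x) = Suc (length x)"
  by (induction G x rule: shift_fracs.induct) auto

lemma mul_tm_run:
  assumes x: "x \<in> lists columns"
  shows "\<exists>k \<le> (2 * nat cbound + 8) * (length x + 1).
    accepts_with_output_in mul_tm x (product x) k"
proof -
  obtain q J y where y: "norm_fracs (shift_fracs (unit_digits x) x) = (q, J, y)" by (metis prod_cases3)
  note in_y = back_in[OF shift_in_lists[OF x unit_digits_in[OF x]] y]
  define z where "z = norm_ints q y"
  have "((Start, 0, initial_tape x), (First, 1, initial_tape x)) \<in> transition mul_tm ^^ Suc 0"
    by (rule step_then_run) (auto simp: initial_tape_simps)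
  moreover have "((First, 1, initial_tape x), (Back zero_array zero_array, Suc (length x), initial_tape (shift_fracs (unit_digits x) x)))
      \<in> transition mul_tm ^^ Suc (length x)"
  proof (cases x)
    case Nil
    then show ?thesis
      using initial_tape_simps(3,5)[of "[] :: column list"]
      by (intro step_then_run) (auto simp: unit_digits_def)
  next
    case (Cons a w)
    obtain I F where a: "a = (I, F)" by fastforce
    show ?thesis
      using run_shift[of F "[(I, I)]" w] initial_tape_simps(6,7)[of "[]" "(I, F)" w]
      by (intro step_then_run[where k = "length x"]) (auto simp: Cons a unit_digits_def)
  qed
  moreover have "((Back zero_array zero_array, Suc (length x), initial_tape (shift_fracs (unit_digits x) x)),
      (Back q J, 0, initial_tape y)) \<in> transition mul_tm ^^ Suc (length x)"
    using run_back[OF y, of "[]"] by (simp add: length_shift)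
  moreover have "((Back q J, 0, initial_tape y), (Fwd q, 1, initial_tape y)) \<in> transition mul_tm ^^ Suc 0"
    by (rule step_then_run) (auto simp: initial_tape_simps)
  moreover have "((Fwd q, 1, initial_tape y), (Trim, length z, initial_tape z))
      \<in> transition mul_tm ^^ Suc (length z)"
    using run_fwd[OF in_y(1,3), of "[]"] by (simp add: z_def)
  moreover obtain k where k: "k \<le> length z"
    "((Trim, length z, initial_tape z), (Trim, length (trim z), initial_tape (trim z))) \<in> transition mul_tm ^^ k"
    using run_trim by blast
  ultimately have run: "((Start, 0, initial_tape x), (Trim, length (trim z), initial_tape (trim z)))
      \<in> transition mul_tm ^^ (Suc 0 + (Suc (length x) + (Suc (length x) + (Suc 0 + (Suc (length z) + k)))))"
    by (intro relpow_trans)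
  have z: "product x = trim z" by (simp add: product_def y z_def)
  have "length y = Suc (length x)" using in_y(4) by (simp add: length_shift)
  then have "length z \<le> Suc (length x) + nat cbound"
    using length_fwd[of q y] by (simp add: z_def)
  then have time: "Suc 0 + (Suc (length x) + (Suc (length x) + (Suc 0 + (Suc (length z) + k))))
      \<le> (2 * nat cbound + 8) * (length x + 1)"
    using k(1) by (simp add: algebra_simps)
  have start: "initial_config mul_tm x = (Start, 0, initial_tape x)"
    by (simp add: initial_config_def mul_tm_def)
  have accepting: "Trim \<in> accepting mul_tm" by (simp add: mul_tm_def)
  have "accepts_with_output_in mul_tm x (product x)
      (Suc 0 + (Suc (length x) + (Suc (length x) + (Suc 0 + (Suc (length z) + k)))))"
    unfolding accepts_with_output_in_def z start
    by (intro exI conjI) (rule run halted_trim accepting initial_tape_output)+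
  with time show ?thesis by blast
qed

theorem pf_linear_time_computable_product:
  assumes "inj_on e columns"
  shows "pf_linear_time_computable (e ` columns) (\<lambda>w. map e (product (map (inv_into columns e) w)))"
proof (rule pf_linear_time_computable_rename[OF pf_mul_tm])
  show "inj_on e (work_letters mul_tm)" using assms by (simp add: mul_tm_def)
  show "product ` lists columns \<subseteq> lists columns" using product_in_lists by blast
qed (rule mul_tm_run)

end

section \<open>Finitely generated groups of rational matrices\<close>

text \<open>
  Adding the inverses turns group generators into semigroup generators, and adding \<open>\<one>\<close> provides a
  nonempty product for the neutral element.
\<close>

lemma (in group) semigroup_generators_of_generate:
  assumes "T \<subseteq> carrier G" "generate G T = carrier G"
  shows "semigroup_generators G (insert \<one> (T \<union> m_inv G ` T))"
proof -
  let ?S = "insert \<one> (T \<union> m_inv G ` T)"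
  have S: "?S \<subseteq> carrier G" using assms(1) by auto
  have closed: "foldr (\<otimes>) xs \<one> \<in> carrier G" if "xs \<in> lists ?S" for xs
    using that S by (induction xs) auto
  have append: "foldr (\<otimes>) (xs @ ys) \<one> = foldr (\<otimes>) xs \<one> \<otimes> foldr (\<otimes>) ys \<one>"
    if "xs \<in> lists ?S" "ys \<in> lists ?S" for xs ys
    using that
  proof (induction xs)
    case (Cons a xs)
    then have "a \<in> carrier G" using S by auto
    with Cons show ?case using closed by (simp add: m_assoc)
  qed (simp add: closed)
  have single: "\<exists>xs\<in>lists ?S. xs \<noteq> [] \<and> g = foldr (\<otimes>) xs \<one>" if "g \<in> ?S" for g
    using that S by (intro bexI[of _ "[g]"]) auto
  have "\<exists>xs\<in>lists ?S. xs \<noteq> [] \<and> g = foldr (\<otimes>) xs \<one>" if "g \<in> generate G T" for g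
    using that
  proof (induction g rule: generate.induct)
    case (eng g h)
    then obtain xs ys where xs: "xs \<in> lists ?S" "xs \<noteq> []" "g = foldr (\<otimes>) xs \<one>"
      and ys: "ys \<in> lists ?S" "h = foldr (\<otimes>) ys \<one>"
      by blast
    have "g \<otimes> h = foldr (\<otimes>) (xs @ ys) \<one>"
      unfolding xs(3) ys(2) by (rule append[OF xs(1) ys(1), symmetric])
    moreover have "xs @ ys \<in> lists ?S" using xs(1) ys(1) by (simp only: append_in_lists_conv)
    ultimately show ?case using xs(2) by blast
  qed (auto intro!: single)
  then show ?thesis using S assms(2) unfolding semigroup_generators_def by blast
qed

lemma common_denominator:
  fixes A :: "rat set"
  assumes "finite A"
  obtains b :: int where "3 \<le> b" "\<And>a. a \<in> A \<Longrightarrow> of_int b * a \<in> \<int>"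
proof -
  have "\<exists>d::int. 0 < d \<and> (\<forall>a\<in>A. of_int d * a \<in> \<int>)"
    using assms
  proof (induction A rule: finite_induct)
    case empty
    show ?case by (intro exI[of _ 1]) auto
  next
    case (insert a A)
    then obtain d :: int where d: "0 < d" "\<forall>a\<in>A. of_int d * a \<in> \<int>" by blast
    obtain p q :: int where a: "a = of_int p / of_int q" "0 < q"
      by (metis quotient_of_div quotient_of_denom_pos surj_pair)
    have "of_int (q * d) * a = of_int (d * p)" using a by simp
    moreover have "of_int (q * d) * c \<in> \<int>" if "c \<in> A" for c
      using d(2) that by (simp add: mult.assoc)
    ultimately show ?case
      using d(1) a(2) by (intro exI[of _ "q * d"]) (auto simp del: of_int_mult)
  qed
  then obtain d :: int where d: "0 < d" "\<forall>a\<in>A. of_int d * a \<in> \<int>" by blast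
  show thesis
  proof
    show "3 \<le> 3 * d" using d(1) by simp
    show "of_int (3 * d) * a \<in> \<int>" if "a \<in> A" for a
    proof -
      have "of_int (3 * d) * a = of_int 3 * (of_int d * a)" by simp
      then show ?thesis using d(2) that by (metis Ints_mult Ints_of_int)
    qed
  qed
qed

text \<open>
  With \<open>b\<close> a common denominator of all entries of all generators, each generator is \<open>C / b\<close> for an
  integral \<open>C\<close>, and the words that the machines produce are trimmed. Right multiplications lead
  from the identity matrix to every element of \<open>H\<close>, so each element has a trimmed word, and
  the existence of finite expansions is a by-product of the machines.
\<close>

theorem cayley_pf_linear_time_wrt_GL_rat:
  assumes H: "subgroup H (GL_rat n)" and S: "finite S"
    and gen: "semigroup_generators ((GL_rat n)\<lparr>carrier := H\<rparr>) S"
  shows "cayley_pf_linear_time_wrt ((GL_rat n)\<lparr>carrier := H\<rparr>) S"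
proof -
  let ?G = "(GL_rat n)\<lparr>carrier := H\<rparr>"
  have mult: "x \<otimes>\<^bsub>?G\<^esub> y = x * y" "x \<otimes>\<^bsub>GL_rat n\<^esub> y = x * y"
    and one: "\<one>\<^bsub>?G\<^esub> = 1\<^sub>m n" for x y
    by (simp_all add: GL_rat_def units_of_def ring_mat_def)
  have H_mat: "H \<subseteq> carrier_mat n n"
    using subgroup.subset[OF H] by (auto simp: GL_rat_def units_of_def ring_mat_def Units_def)
  have H_mult: "x * y \<in> H" if "x \<in> H" "y \<in> H" for x y
    using subgroup.m_closed[OF H that] by (simp add: GL_rat_def units_of_def ring_mat_def)
  have SH: "S \<subseteq> H" using gen by (simp add: semigroup_generators_def)
  have "finite (\<Union>s\<in>S. (\<lambda>ij. s $$ ij) ` ({..<n} \<times> {..<n}))" using S by simp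
  then obtain b :: int where b: "3 \<le> b"
    and int: "\<And>a. a \<in> (\<Union>s\<in>S. (\<lambda>ij. s $$ ij) ` ({..<n} \<times> {..<n})) \<Longrightarrow> of_int b * a \<in> \<int>"
    using common_denominator by blast
  interpret positional n b by unfold_locales (rule b)
  define C where "C s ij = \<lfloor>of_int b * s $$ ij\<rfloor>" for s :: "rat mat" and ij
  have C: "of_int b * s $$ (i, j) = of_int (C s (i, j))" if "s \<in> S" "i < n" "j < n" for s i j
  proof -
    have "of_int b * s $$ (i, j) \<in> \<int>" using that by (intro int) blast
    then show ?thesis unfolding C_def by (metis Ints_cases floor_of_int)
  qed
  let ?f = "\<lambda>s. multiplier.product n b (C s)"
  have product: "?f s x \<in> lists columns"
    "matrix_of (?f s x) = matrix_of x * s"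
    "trim (?f s x) = ?f s x"
    if "s \<in> S" "x \<in> lists columns" for s x
  proof -
    interpret multiplier n b "C s" by unfold_locales
    show "product x \<in> lists columns" by (rule product_in_lists[OF that(2)])
    show "matrix_of (product x) = matrix_of x * s"
      using SH H_mat that by (intro matrix_of_product C) auto
    show "trim (product x) = product x" by (simp add: product_def)
  qed
  define W where "W = {x \<in> lists columns. trim x = x \<and> matrix_of x \<in> H}"
  have closed: "?f s x \<in> W" if "s \<in> S" "x \<in> W" for s x
    using that product[of s x] SH H_mult by (auto simp: W_def)
  have inj: "inj_on matrix_of W"
    unfolding inj_on_def W_def using trim_eqI by (metis (mono_tags, lifting) mem_Collect_eq)
  \<comment> \<open>products are folded to the right, so the starting word is generalised from that of the identity\<close>
  have reach: "matrix_of x * foldr (\<otimes>\<^bsub>?G\<^esub>) xs \<one>\<^bsub>?G\<^esub> \<in> matrix_of ` {x \<in> lists columns. trim x = x}"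
    if "xs \<in> lists S" "x \<in> lists columns" "trim x = x" for xs x
    using that
  proof (induction xs arbitrary: x)
    case Nil
    then show ?case
      unfolding foldr.simps id_apply one right_mult_one_mat[OF matrix_of_carrier] by blast
  next
    case (Cons s xs)
    have in_H: "foldr (\<otimes>\<^bsub>?G\<^esub>) xs \<one>\<^bsub>?G\<^esub> \<in> carrier_mat n n"
      using Cons.hyps(2) SH H_mat by (induction xs) (auto simp: one mult)
    have "s \<in> carrier_mat n n" using Cons.hyps(1) SH H_mat by auto
    then have eq: "matrix_of x * foldr (\<otimes>\<^bsub>?G\<^esub>) (s # xs) \<one>\<^bsub>?G\<^esub> =
        matrix_of (?f s x) * foldr (\<otimes>\<^bsub>?G\<^esub>) xs \<one>\<^bsub>?G\<^esub>"
      using in_H Cons product(2) by (simp add: mult assoc_mult_mat[of _ n n _ n _ n])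
    show ?case unfolding eq by (rule Cons.IH) (use Cons product in blast)+
  qed
  define unit_word :: "column list" where "unit_word = [((\<lambda>(i, j). if i < n \<and> j < n \<and> i = j then 1 else 0), zero_array)]"
  have unit_word: "unit_word \<in> lists columns" "matrix_of unit_word = 1\<^sub>m n"
  proof -
    show "unit_word \<in> lists columns"
      using b by (auto simp: unit_word_def columns_def arrays_def zero_digits)
    show "matrix_of unit_word = 1\<^sub>m n"
      by (auto simp: unit_word_def matrix_of_def)
  qed
  have products: "\<forall>g\<in>H. \<exists>xs\<in>lists S. xs \<noteq> [] \<and> g = foldr (\<otimes>\<^bsub>?G\<^esub>) xs \<one>\<^bsub>?G\<^esub>"
    using gen by (simp add: semigroup_generators_def)
  have "matrix_of ` W = H"
  proof
    show "H \<subseteq> matrix_of ` W"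
    proof
      fix h assume h: "h \<in> H"
      then obtain xs where xs: "xs \<in> lists S" "h = foldr (\<otimes>\<^bsub>?G\<^esub>) xs \<one>\<^bsub>?G\<^esub>"
        using products by blast
      have "matrix_of (trim unit_word) * h \<in> matrix_of ` {x \<in> lists columns. trim x = x}"
        unfolding xs(2) by (rule reach[OF xs(1)]) (simp_all add: trim_in_lists unit_word)
      moreover have "matrix_of (trim unit_word) * h = h"
        using h H_mat by (auto simp: matrix_of_trim unit_word)
      ultimately show "h \<in> matrix_of ` W" using h by (auto simp: W_def)
    qed
  qed (auto simp: W_def)
  with inj have bij: "bij_betw matrix_of W H" by (simp add: bij_betw_def)
  have fin: "finite columns" by (simp add: columns_def finite_arrays)
  then obtain e :: "column \<Rightarrow> nat" where e: "inj_on e columns"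
    using finite_imp_inj_to_nat_seg by blast
  let ?dec = "map (inv_into columns e)"
  have dec: "?dec (map e x) = x" if "x \<in> lists columns" for x
    using that e by (auto simp: in_lists_conv_set intro!: map_idI)
  have W_lists: "W \<subseteq> lists columns" by (auto simp: W_def)
  have bij_dec: "bij_betw ?dec (map e ` W) W"
  proof (rule bij_betw_imageI)
    have dec_W: "?dec (map e x) = x" if "x \<in> W" for x
      by (rule dec) (use that W_lists in blast)
    show "inj_on ?dec (map e ` W)"
      by (rule inj_on_inverseI[where g = "map e"]) (elim imageE, simp only: dec_W)
    show "?dec ` map e ` W = W"
      unfolding image_image by (rule trans[OF image_cong[OF refl dec_W] image_ident])
  qed
  have "bij_betw (matrix_of \<circ> ?dec) (map e ` W) (carrier ?G)"
    using bij_betw_trans[OF bij_dec bij] by simp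
  moreover have "map e ` W \<subseteq> lists (e ` columns)"
    unfolding lists_image by (rule image_mono[OF W_lists])
  moreover have "pf_linear_time_computable (e ` columns)
      (\<lambda>w. map e (?f s (?dec w)))" for s
  proof -
    interpret multiplier n b "C s" by unfold_locales
    show ?thesis by (rule pf_linear_time_computable_product[OF e])
  qed
  moreover have "map e (?f s (?dec w)) \<in> map e ` W"
    "(matrix_of \<circ> ?dec) (map e (?f s (?dec w))) = (matrix_of \<circ> ?dec) w \<otimes>\<^bsub>?G\<^esub> s"
    if s: "s \<in> S" and w: "w \<in> map e ` W" for s w
  proof -
    obtain x where x: "w = map e x" "x \<in> W" using w by blast
    have xl: "x \<in> lists columns" using x(2) W_lists by blast
    have d: "?dec w = x" unfolding x(1) by (rule dec[OF xl])
    show "map e (?f s (?dec w)) \<in> map e ` W"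
      unfolding d by (intro imageI closed s x(2))
    show "(matrix_of \<circ> ?dec) (map e (?f s (?dec w))) = (matrix_of \<circ> ?dec) w \<otimes>\<^bsub>?G\<^esub> s"
      unfolding o_apply d mult dec[OF product(1)[OF s xl]] by (rule product(2)[OF s xl])
  qed
  ultimately show ?thesis
    unfolding cayley_pf_linear_time_wrt_def using fin
    by (intro exI[of _ "e ` columns"] exI[of _ "map e ` W"] exI[of _ "matrix_of \<circ> ?dec"]
        exI[of _ "\<lambda>s w. map e (?f s (?dec w))"]) blast
qed

theorem theorem9:
  fixes n :: nat and H :: "rat mat set"
  assumes "n \<ge> 1"
    and "subgroup H (GL_rat n)"
    and "finitely_generated_group ((GL_rat n)\<lparr>carrier := H\<rparr>)"
  shows "cayley_pf_linear_time_computable ((GL_rat n)\<lparr>carrier := H\<rparr>)"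
proof -
  let ?G = "(GL_rat n)\<lparr>carrier := H\<rparr>"
  obtain T where T: "group ?G" "finite T" "T \<subseteq> carrier ?G" "generate ?G T = carrier ?G"
    using assms(3) unfolding finitely_generated_group_def by blast
  then have "finite (insert \<one>\<^bsub>?G\<^esub> (T \<union> m_inv ?G ` T))" by simp
  moreover have "semigroup_generators ?G (insert \<one>\<^bsub>?G\<^esub> (T \<union> m_inv ?G ` T))"
    by (rule group.semigroup_generators_of_generate[OF T(1,3,4)])
  ultimately show ?thesis
    unfolding cayley_pf_linear_time_computable_def
    using assms(3) cayley_pf_linear_time_wrt_GL_rat[OF assms(2)] by blast
qed

end
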